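(* The only rotation number $Q\in\mathbb{R}^n$ for which there can exist a (continuous time) minimax stationary Mather measure is $Q=0$. That is, if a minimax stationary Mather measure with rotation number $Q$ exists, then $Q=0$.
   Context: $\mathbb{T}^n$ is the $n$-torus $\mathbb{R}^n/\mathbb{Z}^n$. The Lagrangian $L:\mathbb{T}^n\times\mathbb{R}^n\to\mathbb{R}$ is smooth, strictly convex in $v$ with $D^2_{vv}L(x,v)\ge\gamma>0$ for some constant $\gamma$, and coercive: $\lim_{|v|\to\infty}L(x,v)/|v|=\infty$. A probability measure $\mu=\theta(dx)\pi(x,dv)$ on $\mathbb{T}^n\times\mathbb{R}^n$ (where $\theta$ is a Borel probability measure on $\mathbb{T}^n$ and $\pi(x,dv)$ is a plan, i.e. a measurable family of probability measures on $\mathbb{R}^n$), with $\int|v|\,d\mu<\infty$, is called holonomic (continuous time) if $\int v\cdot D_x\varphi(x)\,\pi(x,dv)\,\theta(dx)=0$ for every $C^1$ function $\varphi:\mathbb{T}^n\to\mathbb{R}$. Its rotation number is $\int v\,d\mu\in\mathbb{R}^n$. For $Q\in\mathbb{R}^n$, let $\Pi(\theta,Q)$ be the set of plans $\pi$ such that $\theta\pi$ is holonomic with rotation number $Q$, and set $$g_Q(\theta)=\inf_{\pi\in\Pi(\theta,Q)}\int_{\mathbb{T}^n\times\mathbb{R}^n}L(x,v)\,\pi(x,dv)\,\theta(dx),$$ with $\inf\emptyset=+\infty$. A minimax stationary Mather measure with rotation number $Q$ is a measure $\mu=\theta\pi$ with $\pi\in\Pi(\theta,Q)$ and finite action $\int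 L\,d\mu<\infty$ such that $\int L\,d\mu=g_Q(\theta)=\sup_{\tilde\theta}g_Q(\tilde\theta)$, the supremum being over all Borel probability measures $\tilde\theta$ on $\mathbb{T}^n$. *)

theory Defs
  imports "HOL-Probability.Probability"
begin

section \<open>The torus as the quotient of Euclidean space by the integer lattice\<close>

definition torus_rel :: "real ^ 'n \<Rightarrow> real ^ 'n \<Rightarrow> bool" where
  "torus_rel x y \<longleftrightarrow> (\<forall>i. x $ i - y $ i \<in> \<int>)"

lemma equivp_torus_rel: "equivp (torus_rel :: real ^ ('n::finite) \<Rightarrow> real ^ 'n \<Rightarrow> bool)"
proof (rule equivpI)
  show "reflp (torus_rel :: real ^ ('n::finite) \<Rightarrow> _)"
    by (auto simp: reflp_def torus_rel_def)
  show "symp (torus_rel :: real ^ ('n::finite) \<Rightarrow> _)"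
    unfolding symp_def torus_rel_def by (metis Ints_minus minus_diff_eq)
  show "transp (torus_rel :: real ^ ('n::finite) \<Rightarrow> _)"
    unfolding transp_def torus_rel_def
  proof (intro allI impI)
    fix x y z :: "real ^ 'n" and i
    assume "\<forall>i. x $ i - y $ i \<in> \<int>" "\<forall>i. y $ i - z $ i \<in> \<int>"
    then have "(x $ i - y $ i) + (y $ i - z $ i) \<in> \<int>" by (blast intro: Ints_add)
    then show "x $ i - z $ i \<in> \<int>" by simp
  qed
qed

quotient_type (overloaded) 'n torus = "real ^ ('n::finite)" / torus_rel
  morphisms rep_torus to_torus
  by (rule equivp_torus_rel)

lemma to_torus_eq_iff: "to_torus x = to_torus y \<longleftrightarrow> (\<forall>i. x $ i - y $ i \<in> \<int>)"
  unfolding torus.abs_eq_iff torus_rel_def ..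

lemma to_torus_rep_torus [simp]: "to_torus (rep_torus q) = q"
  by (rule Quotient3_abs_rep[OF Quotient3_torus])

text \<open>The quotient topology.\<close>

instantiation torus :: (finite) topological_space
begin

definition open_torus :: "'a torus set \<Rightarrow> bool" where
  "open_torus U \<longleftrightarrow> open (to_torus -` U)"

instance
proof
  show "open (UNIV :: 'a torus set)" by (simp add: open_torus_def)
  show "open (S \<inter> T)" if "open S" "open T" for S T :: "'a torus set"
    using that by (auto simp: open_torus_def)
  show "open (\<Union>K)" if "\<forall>S\<in>K. open S" for K :: "'a torus set set"
    using that by (auto simp: open_torus_def vimage_Union)
qed

end

lemma continuous_to_torus: "continuous_on UNIV to_torus"
  by (auto simp: continuous_on_open_vimage open_torus_def)

lemma open_to_torus_image:
  assumes "open (S :: (real ^ 'n::finite) set)"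
  shows "open (to_torus ` S)"
proof -
  have "to_torus -` (to_torus ` S) = (\<Union>k\<in>{k. \<forall>i. k $ i \<in> \<int>}. (\<lambda>x. k + x) ` S)"
    (is "?L = ?R")
  proof
    show "?L \<subseteq> ?R"
    proof
      fix y assume "y \<in> ?L"
      then obtain x where x: "x \<in> S" "to_torus y = to_torus x" by auto
      then have "y - x \<in> {k. \<forall>i. k $ i \<in> \<int>}" "y = (y - x) + x"
        by (auto simp: to_torus_eq_iff)
      with x(1) show "y \<in> ?R" by blast
    qed
    show "?R \<subseteq> ?L"
    proof
      fix y assume "y \<in> ?R"
      then obtain k x where k: "\<forall>i. k $ i \<in> \<int>" "x \<in> S" "y = k + x" by blast
      then have "to_torus y = to_torus x" by (simp add: to_torus_eq_iff)
      then show "y \<in> ?L" using k(2) by (metis imageI vimageI)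
    qed
  qed
  then show ?thesis
    unfolding open_torus_def using assms by (simp only:) (intro open_UN ballI open_translation)
qed

instance torus :: (finite) second_countable_topology
proof
  obtain B :: "(real ^ 'a) set set" where B: "countable B" "topological_basis B"
    using ex_countable_basis by blast
  have "topological_basis ((\<lambda>S. to_torus ` S) ` B)"
  proof (rule topological_basisI)
    show "open U" if "U \<in> (\<lambda>S. to_torus ` S) ` B" for U
      using that B(2) by (auto intro!: open_to_torus_image topological_basis_open)
    fix U :: "'a torus set" and q assume U: "open U" "q \<in> U"
    then have "open (to_torus -` U)" "rep_torus q \<in> to_torus -` U"
      by (auto simp: open_torus_def)
    then obtain S where "S \<in> B" "rep_torus q \<in> S" "S \<subseteq> to_torus -` U"
      using B(2) by (metis topological_basisE)
    then show "\<exists>V\<in>(\<lambda>S. to_torus ` S) ` B. q \<in> V \<and> V \<subseteq> U"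
      by (metis image_eqI image_subset_iff_subset_vimage to_torus_rep_torus)
  qed
  then show "\<exists>B :: 'a torus set set. countable B \<and> open = generate_topology B"
    using B(1) by (intro exI[of _ "(\<lambda>S. to_torus ` S) ` B"])
      (auto simp: topological_basis_imp_subbasis)
qed


section \<open>Differentiability classes\<close>

primrec C_class :: "nat \<Rightarrow> ('a::euclidean_space \<Rightarrow> real) \<Rightarrow> bool" where
  "C_class 0 f \<longleftrightarrow> continuous_on UNIV f"
| "C_class (Suc k) f \<longleftrightarrow>
    (\<forall>x. f differentiable (at x)) \<and> (\<forall>h. C_class k (\<lambda>x. frechet_derivative f (at x) h))"

definition torus_C1 :: "('n::finite torus \<Rightarrow> real) \<Rightarrow> bool" where
  "torus_C1 \<phi> \<longleftrightarrow> C_class 1 (\<lambda>y. \<phi> (to_torus y))"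

text \<open>The lift of \<open>\<phi>\<close> is periodic, so the choice of the representative is immaterial
  (see \<open>torus_grad_to_torus\<close> below).\<close>

definition torus_grad :: "('n::finite torus \<Rightarrow> real) \<Rightarrow> 'n torus \<Rightarrow> real ^ 'n" where
  "torus_grad \<phi> x = (THE D. GDERIV (\<lambda>y. \<phi> (to_torus y)) (rep_torus x) :> D)"

lemma torus_grad_to_torus:
  fixes y :: "real ^ 'n::finite"
  assumes "GDERIV (\<lambda>y. \<phi> (to_torus y)) y :> D"
  shows "torus_grad \<phi> (to_torus y) = D"
proof -
  define z where "z = rep_torus (to_torus y)"
  have "to_torus z = to_torus y" by (simp add: z_def)
  then have per: "\<phi> (to_torus (u + (y - z))) = \<phi> (to_torus u)" for u
  proof -
    have "to_torus (u + (y - z)) = to_torus u"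
      using \<open>to_torus z = to_torus y\<close>[symmetric] by (simp add: to_torus_eq_iff)
    then show ?thesis by simp
  qed
  have "((\<lambda>u. \<phi> (to_torus (u + (y - z)))) has_derivative (\<lambda>h. h \<bullet> D)) (at z)"
  proof (rule has_derivative_compose[where f = "\<lambda>u. u + (y - z)" and f' = "\<lambda>h. h"])
    show "((\<lambda>u. u + (y - z)) has_derivative (\<lambda>h. h)) (at z)"
      by (auto intro!: derivative_eq_intros)
    show "((\<lambda>y. \<phi> (to_torus y)) has_derivative (\<lambda>h. h \<bullet> D)) (at (z + (y - z)))"
      using assms by (simp add: gderiv_def)
  qed
  then have D: "GDERIV (\<lambda>y. \<phi> (to_torus y)) z :> D"
    by (simp add: per gderiv_def)
  have "E = D" if "GDERIV (\<lambda>y. \<phi> (to_torus y)) z :> E" for E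
  proof -
    have "(\<lambda>h. h \<bullet> E) = (\<lambda>h. h \<bullet> D)"
      using that D unfolding gderiv_def by (rule has_derivative_unique)
    then have "\<forall>h. h \<bullet> E = h \<bullet> D" by (simp add: fun_eq_iff)
    then show ?thesis by (simp only: vector_eq_ldot)
  qed
  with D show ?thesis
    unfolding torus_grad_def z_def by (intro the_equality)
qed


section \<open>Lagrangians\<close>

definition strictly_convex :: "('a::real_vector \<Rightarrow> real) \<Rightarrow> bool" where
  "strictly_convex f \<longleftrightarrow> (\<forall>x y u. x \<noteq> y \<longrightarrow> 0 < u \<longrightarrow> u < 1 \<longrightarrow>
     f ((1 - u) *\<^sub>R x + u *\<^sub>R y) < (1 - u) * f x + u * f y)"

text \<open>The bound \<open>\<gamma>\<close> on the vertical Hessian is a bound between quadratic forms.\<close>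

definition lagrangian :: "('n::finite torus \<Rightarrow> real ^ 'n \<Rightarrow> real) \<Rightarrow> bool" where
  "lagrangian L \<longleftrightarrow>
     (\<forall>k. C_class k (\<lambda>(y :: real ^ 'n, v). L (to_torus y) v)) \<and>
     (\<forall>x. strictly_convex (L x)) \<and>
     (\<exists>\<gamma>>0. \<forall>x v w. frechet_derivative (\<lambda>u. frechet_derivative (L x) (at u) w) (at v) w
                        \<ge> \<gamma> * (norm w)\<^sup>2) \<and>
     (\<forall>x. filterlim (\<lambda>v. L x v / norm v) at_top at_infinity)"


section \<open>Plans, holonomic measures and minimax measures\<close>

definition torus_probs :: "'n::finite torus measure set" where
  "torus_probs = space (prob_algebra borel)"

definition plans :: "('n::finite torus \<Rightarrow> (real ^ 'n) measure) set" where
  "plans = borel \<rightarrow>\<^sub>M prob_algebra borel"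

text \<open>The measure \<open>\<theta>(dx) \<pi>(x,dv)\<close>.\<close>

definition plan_measure ::
    "'n::finite torus measure \<Rightarrow> ('n torus \<Rightarrow> (real ^ 'n) measure) \<Rightarrow> ('n torus \<times> (real ^ 'n)) measure"
  where "plan_measure \<theta> \<pi> = \<theta> \<bind> (\<lambda>x. distr (\<pi> x) (borel \<Otimes>\<^sub>M borel) (Pair x))"

lemma nn_integral_plan_measure:
  assumes "\<theta> \<in> torus_probs" "\<pi> \<in> plans" "f \<in> borel_measurable (borel \<Otimes>\<^sub>M borel)"
  shows "(\<integral>\<^sup>+z. f z \<partial>plan_measure \<theta> \<pi>) = (\<integral>\<^sup>+x. (\<integral>\<^sup>+v. f (x, v) \<partial>\<pi> x) \<partial>\<theta>)"
proof -
  have sets_\<theta> [measurable_cong]: "sets \<theta> = sets borel"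
    using assms(1) by (simp add: torus_probs_def space_prob_algebra)
  have \<pi> [measurable]: "\<pi> \<in> borel \<rightarrow>\<^sub>M subprob_algebra borel"
    using assms(2) unfolding plans_def by (rule measurable_prob_algebraD)
  have sets_\<pi>: "sets (\<pi> x) = sets borel" for x
    using measurable_space[OF \<pi>, of x] by (simp add: space_subprob_algebra)
  note assms(3) [measurable]
  have "(\<lambda>x. distr (\<pi> x) (borel \<Otimes>\<^sub>M borel) (Pair x)) \<in> \<theta> \<rightarrow>\<^sub>M subprob_algebra (borel \<Otimes>\<^sub>M borel)"
    by (rule measurable_distr2[where M = borel]) measurable
  then have "(\<integral>\<^sup>+z. f z \<partial>plan_measure \<theta> \<pi>)
      = (\<integral>\<^sup>+x. (\<integral>\<^sup>+z. f z \<partial>distr (\<pi> x) (borel \<Otimes>\<^sub>M borel) (Pair x)) \<partial>\<theta>)"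
    unfolding plan_measure_def by (intro nn_integral_bind[OF assms(3)])
  also have "\<dots> = (\<integral>\<^sup>+x. (\<integral>\<^sup>+v. f (x, v) \<partial>\<pi> x) \<partial>\<theta>)"
    by (intro nn_integral_cong nn_integral_distr)
       (auto simp: assms(3) measurable_cong_sets[OF sets_\<pi> refl])
  finally show ?thesis .
qed

definition holonomic :: "('n::finite torus \<times> (real ^ 'n)) measure \<Rightarrow> bool" where
  "holonomic \<mu> \<longleftrightarrow> integrable \<mu> (\<lambda>(x, v). norm v) \<and>
     (\<forall>\<phi>. torus_C1 \<phi> \<longrightarrow> (LINT (x, v)|\<mu>. v \<bullet> torus_grad \<phi> x) = 0)"

definition rotation_number :: "('n::finite torus \<times> (real ^ 'n)) measure \<Rightarrow> real ^ 'n" where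
  "rotation_number \<mu> = (LINT (x, v)|\<mu>. v)"

definition holonomic_plans ::
    "'n::finite torus measure \<Rightarrow> real ^ 'n \<Rightarrow> ('n torus \<Rightarrow> (real ^ 'n) measure) set" where
  "holonomic_plans \<theta> Q =
     {\<pi> \<in> plans. holonomic (plan_measure \<theta> \<pi>) \<and> rotation_number (plan_measure \<theta> \<pi>) = Q}"

text \<open>The integral of \<open>L\<close> as an extended real number: a Lagrangian is bounded below but
  need not be integrable, and the Bochner integral would return \<open>0\<close> where the action is
  \<open>\<infinity>\<close>.  Since \<^const>\<open>ennreal\<close> truncates negative numbers to \<open>0\<close>, the two terms are
  the integrals of the positive part and of the negative part.\<close>

definition action ::
    "('n::finite torus \<Rightarrow> real ^ 'n \<Rightarrow> real) \<Rightarrow> ('n torus \<times> (real ^ 'n)) measure \<Rightarrow> ereal" where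
  "action L \<mu> = enn2ereal (\<integral>\<^sup>+(x, v). ennreal (L x v) \<partial>\<mu>) - enn2ereal (\<integral>\<^sup>+(x, v). ennreal (- L x v) \<partial>\<mu>)"

definition min_action ::
    "('n::finite torus \<Rightarrow> real ^ 'n \<Rightarrow> real) \<Rightarrow> real ^ 'n \<Rightarrow> 'n torus measure \<Rightarrow> ereal" where
  "min_action L Q \<theta> = (INF \<pi>\<in>holonomic_plans \<theta> Q. action L (plan_measure \<theta> \<pi>))"

definition minimax_mather_measure ::
    "('n::finite torus \<Rightarrow> real ^ 'n \<Rightarrow> real) \<Rightarrow> real ^ 'n \<Rightarrow> ('n torus \<times> (real ^ 'n)) measure \<Rightarrow> bool"
  where
  "minimax_mather_measure L Q \<mu> \<longleftrightarrow>
     (\<exists>\<theta>\<in>torus_probs. \<exists>\<pi>\<in>holonomic_plans \<theta> Q.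
        \<mu> = plan_measure \<theta> \<pi> \<and> action L \<mu> < \<infinity> \<and>
        action L \<mu> = min_action L Q \<theta> \<and>
        min_action L Q \<theta> = (SUP \<theta>'\<in>torus_probs. min_action L Q \<theta>'))"

end

theory Submission
  imports Defs
begin

text \<open>The idea is to test the supremum over \<open>\<theta>\<close> on a Dirac mass. If \<open>\<theta>\<close> is the Dirac mass at
  \<open>x\<close>, a plan only matters through the single measure \<open>\<pi> x\<close>, and the holonomy condition reads
  \<open>m \<bullet> D\<phi>(x) = 0\<close> for all \<open>\<phi>\<close>, where \<open>m\<close> is the mean velocity of \<open>\<pi> x\<close>, that is, the rotation
  number. Gradients of \<open>C\<^sup>1\<close> functions at \<open>x\<close> span \<open>\<real>\<^sup>n\<close> (the sines of the coordinates suffice), so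
  \<open>m = 0\<close>: mass sitting at one point cannot rotate (lemma \<open>holonomic_plan_Dirac_rotation\<close>).

  Hence for \<open>Q \<noteq> 0\<close> no plan over a Dirac mass is admissible, the infimum defining \<open>g\<^sub>Q\<close> is there the
  infimum of the empty set, and \<open>sup g\<^sub>Q = \<infinity>\<close>. A measure of finite action cannot attain this
  supremum.\<close>

text \<open>The universal property of the quotient topology. It gives the Borel measurability of gradients
  that changing variables in the holonomy integral requires.\<close>

lemma continuous_on_torus:
  fixes f :: "'n::finite torus \<Rightarrow> 'b::topological_space"
  assumes "continuous_on UNIV (\<lambda>y. f (to_torus y))"
  shows "continuous_on UNIV f"
  using assms unfolding continuous_on_open_vimage[OF open_UNIV] open_torus_def
  by (simp add: vimage_def)

text \<open>The phase \<open>a\<close> is there to place a point of steepest slope at a prescribed point of the torus.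
  Choosing a representative is harmless because the sine has period \<open>1\<close> in the coordinate.\<close>

definition torus_sin :: "real \<Rightarrow> 'n::finite \<Rightarrow> 'n torus \<Rightarrow> real" where
  "torus_sin a i x = sin (2 * pi * (rep_torus x $ i - a))"

lemma rep_torus_to_torus_Ints: "rep_torus (to_torus y) $ i - y $ i \<in> \<int>"
  using to_torus_rep_torus[of "to_torus y"] unfolding to_torus_eq_iff by blast

lemma torus_sin_to_torus: "torus_sin a i (to_torus y) = sin (2 * pi * (y $ i - a))"
proof -
  obtain k :: int where "rep_torus (to_torus y) $ i - y $ i = of_int k"
    using rep_torus_to_torus_Ints by (metis Ints_cases)
  then have "2 * pi * (rep_torus (to_torus y) $ i - a) = 2 * pi * (y $ i - a) + 2 * pi * of_int k"
    by (metis add.commute add_diff_eq diff_add_cancel distrib_left)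
  then show ?thesis
    by (simp add: torus_sin_def sin_add)
qed

lemma GDERIV_torus_sin:
  "GDERIV (\<lambda>y. torus_sin a i (to_torus y)) y :> (2 * pi * cos (2 * pi * (y $ i - a))) *\<^sub>R axis i 1"
  unfolding gderiv_def torus_sin_to_torus
  by (auto intro!: derivative_eq_intros bounded_linear_imp_has_derivative bounded_linear_vec_nth
      simp: inner_axis fun_eq_iff algebra_simps)

lemma torus_grad_torus_sin:
  "torus_grad (torus_sin a i) (to_torus y) = (2 * pi * cos (2 * pi * (y $ i - a))) *\<^sub>R axis i 1"
  by (rule torus_grad_to_torus[OF GDERIV_torus_sin])

lemma torus_C1_torus_sin: "torus_C1 (torus_sin a i)"
proof -
  have D: "((\<lambda>y. torus_sin a i (to_torus y)) has_derivative
      (\<lambda>h. h \<bullet> (2 * pi * cos (2 * pi * (y $ i - a))) *\<^sub>R axis i 1)) (at y)" for y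
    using GDERIV_torus_sin unfolding gderiv_def .
  show ?thesis
    unfolding torus_C1_def One_nat_def C_class.simps
    by (auto simp: frechet_derivative_at[OF D, symmetric] intro!: continuous_intros
        differentiableI[OF D])
qed

lemma continuous_torus_grad_torus_sin: "continuous_on UNIV (torus_grad (torus_sin a i))"
  by (rule continuous_on_torus) (auto simp: torus_grad_torus_sin intro!: continuous_intros)

lemma plan_measure_Dirac:
  assumes "\<pi> \<in> plans"
  shows "plan_measure (return borel x) \<pi> = distr (\<pi> x) (borel \<Otimes>\<^sub>M borel) (Pair x)"
proof -
  have [measurable]: "\<pi> \<in> borel \<rightarrow>\<^sub>M subprob_algebra borel"
    using assms unfolding plans_def by (rule measurable_prob_algebraD)
  have "(\<lambda>x. distr (\<pi> x) (borel \<Otimes>\<^sub>M borel) (Pair x)) \<in> borel \<rightarrow>\<^sub>M subprob_algebra (borel \<Otimes>\<^sub>M borel)"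
    by (rule measurable_distr2[where M = borel]) measurable
  then show ?thesis
    unfolding plan_measure_def by (rule bind_return) simp
qed

text \<open>Testing holonomy at \<open>x\<close> against \<open>sin (2 * pi * (y\<^sub>i - x\<^sub>i))\<close>, whose gradient at \<open>x\<close> is a nonzero
  multiple of the \<open>i\<close>-th unit vector, kills the \<open>i\<close>-th component of the mean velocity.\<close>

lemma holonomic_plan_Dirac_rotation:
  assumes "\<pi> \<in> holonomic_plans (return borel x) Q"
  shows "Q = 0"
proof -
  let ?\<mu> = "plan_measure (return borel x) \<pi>"
  have \<pi>: "\<pi> \<in> plans" and hol: "holonomic ?\<mu>" and rot: "rotation_number ?\<mu> = Q"
    using assms by (auto simp: holonomic_plans_def)
  have [measurable_cong]: "sets (\<pi> x) = sets borel"
    using measurable_space[of \<pi> borel "prob_algebra borel" x] \<pi>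
    by (simp add: plans_def space_prob_algebra)
  have \<mu>: "?\<mu> = distr (\<pi> x) (borel \<Otimes>\<^sub>M borel) (Pair x)"
    by (rule plan_measure_Dirac[OF \<pi>])
  have mean: "Q = (\<integral>v. v \<partial>\<pi> x)"
    using rot unfolding rotation_number_def \<mu> by (subst (asm) integral_distr) auto
  have "integrable (\<pi> x) (\<lambda>v. norm v)"
    using hol unfolding holonomic_def \<mu> by (simp add: integrable_distr_eq)
  then have int: "integrable (\<pi> x) (\<lambda>v. v)"
    by (rule integrable_norm_cancel) measurable
  have "Q $ i = 0" for i
  proof -
    let ?\<phi> = "torus_sin (rep_torus x $ i) i"
    have [measurable]: "torus_grad ?\<phi> \<in> borel_measurable borel"
      by (rule borel_measurable_continuous_onI[OF continuous_torus_grad_torus_sin])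
    have "0 = (LINT (y, v)|?\<mu>. v \<bullet> torus_grad ?\<phi> y)"
      using hol torus_C1_torus_sin unfolding holonomic_def by metis
    also have "\<dots> = (\<integral>v. v \<bullet> torus_grad ?\<phi> x \<partial>\<pi> x)"
      unfolding \<mu> by (subst integral_distr) auto
    also have "\<dots> = Q \<bullet> torus_grad ?\<phi> x"
      unfolding mean by (rule integral_inner_left) (rule int)
    also have "torus_grad ?\<phi> x = (2 * pi) *\<^sub>R axis i 1"
      using torus_grad_torus_sin[of "rep_torus x $ i" i "rep_torus x"] by simp
    finally show ?thesis
      by (simp add: inner_axis)
  qed
  then show ?thesis
    by (simp add: vec_eq_iff)
qed

lemma min_action_Dirac:
  assumes "Q \<noteq> 0"
  shows "min_action L Q (return borel x) = \<infinity>"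
proof -
  have "holonomic_plans (return borel x) Q = {}"
    using holonomic_plan_Dirac_rotation assms by blast
  then show ?thesis
    by (simp add: min_action_def top_ereal_def)
qed

theorem proposition7p3:
  fixes L :: "'n::finite torus \<Rightarrow> real ^ 'n \<Rightarrow> real"
    and Q :: "real ^ 'n"
    and \<mu> :: "('n torus \<times> (real ^ 'n)) measure"
  assumes "lagrangian L"
    and "minimax_mather_measure L Q \<mu>"
  shows "Q = 0"
proof (rule ccontr)
  assume "Q \<noteq> 0"
  define \<delta> :: "'n torus measure" where "\<delta> = return borel (to_torus 0)"
  have "\<delta> \<in> torus_probs"
    by (auto simp: \<delta>_def torus_probs_def space_prob_algebra intro: prob_space_return)
  then have "min_action L Q \<delta> \<le> (SUP \<theta>\<in>torus_probs. min_action L Q \<theta>)"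
    by (rule SUP_upper)
  \<comment> \<open>The supremum equals the action of \<open>\<mu>\<close>.\<close>
  also have "\<dots> < \<infinity>"
    using assms(2) by (auto simp: minimax_mather_measure_def)
  finally show False
    using min_action_Dirac[OF \<open>Q \<noteq> 0\<close>] by (simp add: \<delta>_def)
qed

end
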